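(* Let $m,n$ be non-zero integers with $|m|\neq|n|$. Then $\ker\pi$ is trivial, $G_{m,n}$ is a totally disconnected, locally compact (Hausdorff) topological group, and $\pi$ embeds $\mathrm{BS}(m,n)$ as a dense subgroup of $G_{m,n}$.
   Context: $\mathrm{BS}(m,n)=\langle a,t\mid ta^mt^{-1}=a^n\rangle$. Let $\pi:\mathrm{BS}(m,n)\to \mathrm{Sym}(\mathrm{BS}(m,n)/\langle a\rangle)$ be the action by left multiplication on left cosets of $\langle a\rangle$. $\mathrm{Sym}(\mathrm{BS}(m,n)/\langle a\rangle)$ has the topology of pointwise convergence, with basis the sets $\mathcal N(x,F)=\{y\mid y(c)=x(c)\ \forall c\in F\}$, $F$ a finite set of cosets. $G_{m,n}$ is the closure of the image of $\pi$ in $\mathrm{Sym}(\mathrm{BS}(m,n)/\langle a\rangle)$, with the subspace topology. *)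

theory Defs
  imports "HOL-Analysis.Analysis" "HOL-Algebra.Algebra"
begin

section \<open>Groups given by a presentation\<close>

text \<open>The letter \<open>(x, True)\<close> stands for the generator \<open>x\<close> and \<open>(x, False)\<close> for its formal inverse.\<close>

type_synonym 'g word = "('g \<times> bool) list"

text \<open>
  The least congruence on words that identifies the two sides of every relation in \<open>R\<close> and
  allows free cancellation.  A relation \<open>u = v\<close> is encoded as the pair \<open>(u, v)\<close>.
\<close>

inductive word_eq :: "('g word \<times> 'g word) set \<Rightarrow> 'g word \<Rightarrow> 'g word \<Rightarrow> bool"
  for R :: "('g word \<times> 'g word) set"
where
  refl: "word_eq R u u"
| sym: "word_eq R u v \<Longrightarrow> word_eq R v u"
| trans: "word_eq R u v \<Longrightarrow> word_eq R v w \<Longrightarrow> word_eq R u w"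
| cancel: "word_eq R (p @ [(x, b), (x, \<not> b)] @ q) (p @ q)"
| relation: "(u, v) \<in> R \<Longrightarrow> word_eq R (p @ u @ q) (p @ v @ q)"

definition word_class :: "('g word \<times> 'g word) set \<Rightarrow> 'g word \<Rightarrow> 'g word set"
  where "word_class R u = {v. word_eq R u v}"

definition presented_group :: "('g word \<times> 'g word) set \<Rightarrow> 'g word set monoid"
  where "presented_group R =
    \<lparr>carrier = range (word_class R),
     mult = (\<lambda>A B. {w. \<exists>u\<in>A. \<exists>v\<in>B. word_eq R (u @ v) w}),
     one = word_class R []\<rparr>"

definition word_power :: "'g \<Rightarrow> int \<Rightarrow> 'g word"
  where "word_power x k = replicate (nat \<bar>k\<bar>) (x, 0 \<le> k)"

lemma word_class_eq_iff: "word_class R u = word_class R v \<longleftrightarrow> word_eq R u v"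
  unfolding word_class_def by (blast intro: word_eq.refl word_eq.sym word_eq.trans)

lemma word_eq_context: "word_eq R u v \<Longrightarrow> word_eq R (p @ u @ q) (p @ v @ q)"
proof (induction rule: word_eq.induct)
  case (cancel p' x b q')
  then show ?case using word_eq.cancel[of R "p @ p'" x b "q' @ q"] by simp
next
  case (relation u v p' q')
  then show ?case using word_eq.relation[of u v R "p @ p'" "q' @ q"] by simp
qed (blast intro: word_eq.refl word_eq.sym word_eq.trans)+

lemma word_eq_append:
  assumes "word_eq R u u'" "word_eq R v v'"
  shows "word_eq R (u @ v) (u' @ v')"
  using word_eq_context[OF assms(1), of "[]" v] word_eq_context[OF assms(2), of u' "[]"]
  by (auto intro: word_eq.trans)

lemma presented_group_mult:
  "word_class R u \<otimes>\<^bsub>presented_group R\<^esub> word_class R v = word_class R (u @ v)"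
  unfolding presented_group_def word_class_def
  by (auto intro: word_eq.refl word_eq.trans word_eq_append)

lemma word_eq_inverse: "word_eq R (rev (map (\<lambda>(x, b). (x, \<not> b)) u) @ u) []"
proof (induction u)
  case (Cons a u)
  obtain x b where a: "a = (x, b)" by (cases a)
  let ?i = "rev (map (\<lambda>(x, b). (x, \<not> b)) u)"
  have "word_eq R (?i @ [(x, \<not> b), (x, \<not> \<not> b)] @ u) (?i @ u)"
    by (rule word_eq.cancel)
  then show ?case using Cons.IH by (auto simp: a intro: word_eq.trans)
qed (simp add: word_eq.refl)

lemma group_presented_group: "group (presented_group R)"
proof (rule groupI)
  have carr: "carrier (presented_group R) = range (word_class R)"
    and I: "\<one>\<^bsub>presented_group R\<^esub> = word_class R []"
    by (simp_all add: presented_group_def)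
  show "\<one>\<^bsub>presented_group R\<^esub> \<in> carrier (presented_group R)" by (simp add: carr I)
  show "A \<otimes>\<^bsub>presented_group R\<^esub> B \<in> carrier (presented_group R)"
    if "A \<in> carrier (presented_group R)" "B \<in> carrier (presented_group R)" for A B
    using that by (auto simp: carr presented_group_mult)
  show "A \<otimes>\<^bsub>presented_group R\<^esub> B \<otimes>\<^bsub>presented_group R\<^esub> C =
      A \<otimes>\<^bsub>presented_group R\<^esub> (B \<otimes>\<^bsub>presented_group R\<^esub> C)"
    if "A \<in> carrier (presented_group R)" "B \<in> carrier (presented_group R)"
      "C \<in> carrier (presented_group R)" for A B C
    using that by (auto simp: carr presented_group_mult)
  show "\<one>\<^bsub>presented_group R\<^esub> \<otimes>\<^bsub>presented_group R\<^esub> A = A"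
    if "A \<in> carrier (presented_group R)" for A
    using that by (auto simp: carr I presented_group_mult)
  show "\<exists>B\<in>carrier (presented_group R). B \<otimes>\<^bsub>presented_group R\<^esub> A = \<one>\<^bsub>presented_group R\<^esub>"
    if "A \<in> carrier (presented_group R)" for A
    using that word_eq_inverse by (fastforce simp: carr I presented_group_mult word_class_eq_iff)
qed


section \<open>Topologies on permutation groups\<close>

definition agree_nbhd :: "'a set \<Rightarrow> ('a \<Rightarrow> 'a) \<Rightarrow> 'a set \<Rightarrow> ('a \<Rightarrow> 'a) set"
  where "agree_nbhd S x F = {y \<in> carrier (BijGroup S). \<forall>c\<in>F. y c = x c}"

text \<open>The generating sets form a basis, not just a subbasis; see \<open>openin_sym_topology\<close>.\<close>

definition sym_topology :: "'a set \<Rightarrow> ('a \<Rightarrow> 'a) topology"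
  where "sym_topology S = topology_generated_by
    {agree_nbhd S x F | x F. x \<in> carrier (BijGroup S) \<and> finite F \<and> F \<subseteq> S}"

lemma openin_sym_topology:
  "openin (sym_topology S) U \<longleftrightarrow> U \<subseteq> carrier (BijGroup S) \<and>
     (\<forall>x\<in>U. \<exists>F. finite F \<and> F \<subseteq> S \<and> agree_nbhd S x F \<subseteq> U)"
  (is "?L \<longleftrightarrow> ?R")
proof
  let ?B = "{agree_nbhd S x F | x F. x \<in> carrier (BijGroup S) \<and> finite F \<and> F \<subseteq> S}"
  assume ?L
  then have "generate_topology_on ?B U"
    by (simp add: sym_topology_def openin_topology_generated_by_iff)
  then show ?R
  proof induction
    case (Int a b)
    show ?case
    proof (intro conjI ballI)
      fix x assume "x \<in> a \<inter> b"
      then obtain F F' where "finite F" "F \<subseteq> S" "agree_nbhd S x F \<subseteq> a"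
        "finite F'" "F' \<subseteq> S" "agree_nbhd S x F' \<subseteq> b"
        using Int.IH by blast
      then show "\<exists>F. finite F \<and> F \<subseteq> S \<and> agree_nbhd S x F \<subseteq> a \<inter> b"
        by (intro exI[of _ "F \<union> F'"]) (auto simp: agree_nbhd_def)
    qed (use Int.IH in blast)
  next
    case (UN K)
    then show ?case by (meson Sup_least UnionE Sup_upper order_trans)
  next
    case (Basis s)
    then obtain x F where "s = agree_nbhd S x F" "finite F" "F \<subseteq> S" by blast
    then show ?case by (auto simp: agree_nbhd_def intro!: exI[of _ F])
  qed simp
next
  assume R: ?R
  show ?L
  proof (subst openin_subopen, intro ballI)
    fix x assume x: "x \<in> U"
    then obtain F where F: "finite F" "F \<subseteq> S" "agree_nbhd S x F \<subseteq> U" using R by blast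
    have "openin (sym_topology S) (agree_nbhd S x F)"
      unfolding sym_topology_def using F R x by (intro topology_generated_by_Basis) blast
    moreover have "x \<in> agree_nbhd S x F" using R x by (auto simp: agree_nbhd_def)
    ultimately show "\<exists>T. openin (sym_topology S) T \<and> x \<in> T \<and> T \<subseteq> U" using F by blast
  qed
qed

definition topological_group :: "('a, 'b) monoid_scheme \<Rightarrow> 'a topology \<Rightarrow> bool"
  where "topological_group G T \<longleftrightarrow>
    group G \<and> topspace T = carrier G \<and>
    continuous_map (prod_topology T T) T (\<lambda>(x, y). x \<otimes>\<^bsub>G\<^esub> y) \<and>
    continuous_map T T (\<lambda>x. inv\<^bsub>G\<^esub> x)"

definition totally_disconnected_space :: "'a topology \<Rightarrow> bool"
  where "totally_disconnected_space T \<longleftrightarrow> (\<forall>S. connectedin T S \<longrightarrow> (\<exists>x. S \<subseteq> {x}))"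


section \<open>Baumslag--Solitar groups and the closures \<open>G\<^bsub>m,n\<^esub>\<close>\<close>

datatype bs_gen = Gen_a | Gen_t

definition BS_relations :: "int \<Rightarrow> int \<Rightarrow> (bs_gen word \<times> bs_gen word) set"
  where "BS_relations m n =
    {(word_power Gen_t 1 @ word_power Gen_a m @ word_power Gen_t (- 1), word_power Gen_a n)}"

definition BS :: "int \<Rightarrow> int \<Rightarrow> bs_gen word set monoid"
  where "BS m n = presented_group (BS_relations m n)"

definition BS_a :: "int \<Rightarrow> int \<Rightarrow> bs_gen word set"
  where "BS_a m n = word_class (BS_relations m n) (word_power Gen_a 1)"

definition BS_cosets :: "int \<Rightarrow> int \<Rightarrow> bs_gen word set set set"
  where "BS_cosets m n = lcosets\<^bsub>BS m n\<^esub> (generate (BS m n) {BS_a m n})"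

definition BS_perm ::
    "int \<Rightarrow> int \<Rightarrow> bs_gen word set \<Rightarrow> bs_gen word set set \<Rightarrow> bs_gen word set set"
  where "BS_perm m n g = (\<lambda>C\<in>BS_cosets m n. g <#\<^bsub>BS m n\<^esub> C)"

definition BS_closure :: "int \<Rightarrow> int \<Rightarrow> (bs_gen word set set \<Rightarrow> bs_gen word set set) monoid"
  where "BS_closure m n = BijGroup (BS_cosets m n)
    \<lparr>carrier := sym_topology (BS_cosets m n) closure_of (BS_perm m n ` carrier (BS m n))\<rparr>"

definition BS_closure_topology ::
    "int \<Rightarrow> int \<Rightarrow> (bs_gen word set set \<Rightarrow> bs_gen word set set) topology"
  where "BS_closure_topology m n =
    subtopology (sym_topology (BS_cosets m n)) (carrier (BS_closure m n))"

end

theory Submission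
  imports Defs
begin

text \<open>
  Write \<open>\<Gamma>\<close> for the image of \<open>\<pi>\<close>, acting on the set \<open>S\<close> of left cosets of \<open>\<langle>a\<rangle>\<close>.

  The kernel of \<open>\<pi>\<close> is a normal subgroup contained in the stabilizer \<open>\<langle>a\<rangle>\<close> of the base coset.  The
  affine action \<open>a x = x + 1\<close>, \<open>t x = (n / m) x\<close> on the real line shows that \<open>a\<close> has infinite order
  (\<open>BS_a_infinite_order\<close>).  If \<open>a [^] k\<close> is a non-trivial power of \<open>a\<close> in the kernel with \<open>\<bar>k\<bar>\<close>
  minimal, then conjugating by \<open>t\<close> multiplies the exponent by \<open>n / m\<close> and conjugating by the inverse
  of \<open>t\<close> multiplies it by \<open>m / n\<close>; both results are again in the kernel, and as \<open>\<bar>m\<bar> \<noteq> \<bar>n\<bar>\<close> one of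
  them is smaller, a contradiction (\<open>trivial_normal_subgroup_of_cyclic\<close>).

  The symmetric group of \<open>S\<close> carries the topology induced from a power of a discrete space.  It is
  therefore a Hausdorff, totally disconnected topological group, and these properties pass to the
  closure of \<open>\<Gamma>\<close>, which is again a subgroup (\<open>subgroup_closure_of\<close>).

  For local compactness, every element of the Baumslag--Solitar group conjugates some non-trivial
  power of \<open>a\<close> to a non-trivial power of \<open>a\<close>: such elements form a subgroup containing \<open>a\<close> and \<open>t\<close>.
  Hence \<open>\<langle>a\<rangle>\<close> has finite orbits on \<open>S\<close> (\<open>finite_cyclic_orbit_on_cosets\<close>).  The stabilizer of the
  base coset in the closure is an open subgroup with the same finite orbits, so it is a closed subset
  of a product of finite sets and thus compact
  (\<open>locally_compact_space_closure_of_permutations\<close>).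
\<close>

section \<open>The pointwise topology on permutations\<close>

lemma carrier_BijGroup: "carrier (BijGroup S) = Bij S"
  by (simp add: BijGroup_def)

lemma mult_BijGroup_apply:
  "x \<in> Bij S \<Longrightarrow> y \<in> Bij S \<Longrightarrow> c \<in> S \<Longrightarrow> (x \<otimes>\<^bsub>BijGroup S\<^esub> y) c = x (y c)"
  by (simp add: BijGroup_def compose_def)

lemma one_BijGroup_apply: "c \<in> S \<Longrightarrow> \<one>\<^bsub>BijGroup S\<^esub> c = c"
  by (simp add: BijGroup_def)

lemma inv_BijGroup_apply_eq:
  assumes "x \<in> Bij S" "c \<in> S" "d \<in> S"
  shows "(inv\<^bsub>BijGroup S\<^esub> x) c = d \<longleftrightarrow> x d = c"
  using assms by (auto simp: inv_BijGroup Bij_def bij_betw_def f_inv_into_f)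

lemma Bij_apply: "x \<in> Bij S \<Longrightarrow> c \<in> S \<Longrightarrow> x c \<in> S"
  using Bij_imp_funcset by blast

text \<open>
  The pointwise topology is the one inherited from the power of the discrete space \<open>S\<close>.
  This makes the Hausdorff property, coordinatewise continuity and Tychonoff's theorem available.
\<close>
lemma sym_topology_eq_subtopology_product:
  "sym_topology S = subtopology (product_topology (\<lambda>_. discrete_topology S) S) (Bij S)"
proof (subst topology_eq, intro allI iffI)
  let ?P = "product_topology (\<lambda>_. discrete_topology S) S"
  fix U
  assume U: "openin (sym_topology S) U"
  show "openin (subtopology ?P (Bij S)) U"
  proof (subst openin_subopen, intro ballI)
    fix x assume "x \<in> U"
    with U obtain F where F: "finite F" "F \<subseteq> S" "agree_nbhd S x F \<subseteq> U" "x \<in> Bij S"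
      unfolding openin_sym_topology carrier_BijGroup by blast
    let ?V = "PiE S (\<lambda>c. if c \<in> F then {x c} else S)"
    have "openin ?P ?V"
      by (rule product_topology_basis)
         (use F in \<open>auto intro: Bij_apply finite_subset[of _ F]\<close>)
    then have "openin (subtopology ?P (Bij S)) (?V \<inter> Bij S)"
      by (auto simp: openin_subtopology)
    moreover have "x \<in> ?V \<inter> Bij S"
      using F by (auto simp: PiE_def Bij_apply Bij_imp_extensional)
    moreover have "?V \<inter> Bij S \<subseteq> U"
    proof -
      have "?V \<inter> Bij S \<subseteq> agree_nbhd S x F"
      proof
        fix y assume y: "y \<in> ?V \<inter> Bij S"
        have "y c = x c" if "c \<in> F" for c
          using y that F(2) PiE_mem[of y S "\<lambda>c. if c \<in> F then {x c} else S" c] by auto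
        then show "y \<in> agree_nbhd S x F"
          using y by (simp add: agree_nbhd_def carrier_BijGroup)
      qed
      then show ?thesis using F(3) by blast
    qed
    ultimately show "\<exists>T. openin (subtopology ?P (Bij S)) T \<and> x \<in> T \<and> T \<subseteq> U" by blast
  qed
next
  let ?P = "product_topology (\<lambda>_. discrete_topology S) S"
  fix U
  assume "openin (subtopology ?P (Bij S)) U"
  then obtain V where V: "openin ?P V" "U = V \<inter> Bij S"
    by (auto simp: openin_subtopology)
  show "openin (sym_topology S) U"
    unfolding openin_sym_topology carrier_BijGroup
  proof (intro conjI ballI)
    show "U \<subseteq> Bij S" using V by blast
    fix x assume x: "x \<in> U"
    then obtain W where W: "finite {i \<in> S. W i \<noteq> S}" "x \<in> PiE S W" "PiE S W \<subseteq> V"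
      using V by (auto simp: openin_product_topology_alt)
    have "agree_nbhd S x {i \<in> S. W i \<noteq> S} \<subseteq> PiE S W"
    proof
      fix y assume y: "y \<in> agree_nbhd S x {i \<in> S. W i \<noteq> S}"
      then have yB: "y \<in> Bij S" by (simp add: agree_nbhd_def carrier_BijGroup)
      have "y i \<in> W i" if "i \<in> S" for i
      proof (cases "W i = S")
        case True then show ?thesis using yB that by (simp add: Bij_apply)
      next
        case False
        then have "y i = x i" using y that by (auto simp: agree_nbhd_def)
        then show ?thesis using W(2) that by auto
      qed
      then show "y \<in> PiE S W" using yB by (auto simp: PiE_def Bij_imp_extensional)
    qed
    moreover have "agree_nbhd S x {i \<in> S. W i \<noteq> S} \<subseteq> Bij S"
      by (auto simp: agree_nbhd_def carrier_BijGroup)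
    ultimately show "\<exists>F. finite F \<and> F \<subseteq> S \<and> agree_nbhd S x F \<subseteq> U"
      using W V by (intro exI[of _ "{i \<in> S. W i \<noteq> S}"]) auto
  qed
qed

lemma topspace_sym_topology: "topspace (sym_topology S) = Bij S"
  by (auto simp: sym_topology_eq_subtopology_product PiE_def Bij_imp_extensional Bij_apply)

lemma Hausdorff_space_sym_topology: "Hausdorff_space (sym_topology S)"
  by (simp add: sym_topology_eq_subtopology_product Hausdorff_space_subtopology
      Hausdorff_space_product_topology)

lemma continuous_map_sym_topology_eval:
  "c \<in> S \<Longrightarrow> continuous_map (sym_topology S) (discrete_topology S) (\<lambda>x. x c)"
  unfolding sym_topology_eq_subtopology_product
  by (intro continuous_map_from_subtopology continuous_map_product_projection)

text \<open>
  These clopen sets separate permutations, which is what makes the space totally disconnected, and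
  they include the point stabilizers, whence the stabilizers are closed as well as open.
\<close>
lemma clopen_sym_topology_eval:
  assumes "c \<in> S"
  shows "openin (sym_topology S) {x \<in> Bij S. x c = d}"
    and "closedin (sym_topology S) {x \<in> Bij S. x c = d}"
proof -
  have *: "{x \<in> Bij S. x c = d} = {x \<in> topspace (sym_topology S). x c \<in> S \<inter> {d}}"
    using assms by (auto simp: topspace_sym_topology Bij_apply)
  show "openin (sym_topology S) {x \<in> Bij S. x c = d}"
    unfolding * by (rule openin_continuous_map_preimage[OF continuous_map_sym_topology_eval[OF assms]]) auto
  show "closedin (sym_topology S) {x \<in> Bij S. x c = d}"
    unfolding * by (rule closedin_continuous_map_preimage[OF continuous_map_sym_topology_eval[OF assms]]) auto
qed

lemma continuous_map_into_sym_topology: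
  assumes f: "\<And>p. p \<in> topspace Y \<Longrightarrow> f p \<in> Bij S"
    and op: "\<And>c d. c \<in> S \<Longrightarrow> d \<in> S \<Longrightarrow> openin Y {p \<in> topspace Y. f p c = d}"
  shows "continuous_map Y (sym_topology S) f"
  unfolding sym_topology_eq_subtopology_product continuous_map_in_subtopology
    continuous_map_componentwise
proof (intro conjI ballI)
  show "f \<in> topspace Y \<rightarrow> Bij S" using f by blast
  show "f ` topspace Y \<subseteq> extensional S" using f Bij_imp_extensional by blast
  fix c assume c: "c \<in> S"
  show "continuous_map Y (discrete_topology S) (\<lambda>p. f p c)"
    unfolding continuous_map_def
  proof (intro conjI allI impI)
    show "(\<lambda>p. f p c) \<in> topspace Y \<rightarrow> topspace (discrete_topology S)"
      using f c Bij_apply by fastforce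
    fix U assume "openin (discrete_topology S) U"
    then have U: "U \<subseteq> S" by simp
    have "{p \<in> topspace Y. f p c \<in> U} = (\<Union>d\<in>U. {p \<in> topspace Y. f p c = d})" by blast
    moreover have "openin Y (\<Union>d\<in>U. {p \<in> topspace Y. f p c = d})"
      by (rule openin_Union) (use op[OF c] U in blast)
    ultimately show "openin Y {p \<in> topspace Y. f p c \<in> U}" by simp
  qed
qed

text \<open>
  The value of a product, \<open>x (y c)\<close>, is determined by the value \<open>e\<close> of \<open>y\<close> at \<open>c\<close> and the value
  of \<open>x\<close> at \<open>e\<close>; the value of \<open>inv x\<close> at \<open>c\<close> is \<open>d\<close> exactly when \<open>x d = c\<close>.  So both operations
  pull prescribed values back to unions of finite intersections of prescribed values.
\<close>
lemma topological_group_sym_topology: "topological_group (BijGroup S) (sym_topology S)"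
  unfolding topological_group_def
proof (intro conjI)
  let ?T = "sym_topology S"
  interpret group "BijGroup S" by (rule group_BijGroup)
  have mult: "x \<otimes>\<^bsub>BijGroup S\<^esub> y \<in> Bij S" if "x \<in> Bij S" "y \<in> Bij S" for x y
    using that m_closed by (simp add: carrier_BijGroup)
  have inv: "inv\<^bsub>BijGroup S\<^esub> x \<in> Bij S" if "x \<in> Bij S" for x
    using that inv_closed by (simp add: carrier_BijGroup)
  show "group (BijGroup S)" by (rule group_BijGroup)
  show "topspace ?T = carrier (BijGroup S)"
    by (simp add: topspace_sym_topology carrier_BijGroup)
  show "continuous_map (prod_topology ?T ?T) ?T (\<lambda>(x, y). x \<otimes>\<^bsub>BijGroup S\<^esub> y)"
  proof (rule continuous_map_into_sym_topology)
    fix c d assume c: "c \<in> S" and d: "d \<in> S"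
    have "{p \<in> topspace (prod_topology ?T ?T). (case p of (x, y) \<Rightarrow> x \<otimes>\<^bsub>BijGroup S\<^esub> y) c = d}
        = (\<Union>e\<in>S. {x \<in> Bij S. x e = d} \<times> {y \<in> Bij S. y c = e})"
      using c by (auto simp: topspace_sym_topology mult_BijGroup_apply Bij_apply)
    then show "openin (prod_topology ?T ?T)
        {p \<in> topspace (prod_topology ?T ?T). (case p of (x, y) \<Rightarrow> x \<otimes>\<^bsub>BijGroup S\<^esub> y) c = d}"
      using c by (auto simp: openin_prod_Times_iff intro!: clopen_sym_topology_eval)
  qed (auto simp: topspace_sym_topology mult)
  show "continuous_map ?T ?T (\<lambda>x. inv\<^bsub>BijGroup S\<^esub> x)"
  proof (rule continuous_map_into_sym_topology)
    fix c d assume c: "c \<in> S" and d: "d \<in> S"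
    have "{x \<in> topspace ?T. (inv\<^bsub>BijGroup S\<^esub> x) c = d} = {x \<in> Bij S. x d = c}"
      using inv_BijGroup_apply_eq[OF _ c d] by (auto simp: topspace_sym_topology)
    then show "openin ?T {x \<in> topspace ?T. (inv\<^bsub>BijGroup S\<^esub> x) c = d}"
      using clopen_sym_topology_eval(1)[OF d] by simp
  qed (auto simp: topspace_sym_topology inv)
qed

lemma totally_disconnected_space_sym_topology:
  "totally_disconnected_space (sym_topology S)"
  unfolding totally_disconnected_space_def
proof (intro allI impI)
  fix C assume C: "connectedin (sym_topology S) C"
  have "x = y" if x: "x \<in> C" and y: "y \<in> C" for x y
  proof -
    have B: "x \<in> Bij S" "y \<in> Bij S"
      using connectedin_subset_topspace[OF C] x y by (auto simp: topspace_sym_topology)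
    have "y c = x c" if c: "c \<in> S" for c
    proof -
      have "C \<subseteq> {z \<in> Bij S. z c = x c} \<or> disjnt C {z \<in> Bij S. z c = x c}"
        using connectedin_clopen_cases[OF C] clopen_sym_topology_eval[OF c] by blast
      then show ?thesis using x y B unfolding disjnt_iff by blast
    qed
    then show ?thesis
      using B Bij_imp_extensional by (metis extensionalityI)
  qed
  then show "\<exists>x. C \<subseteq> {x}" by blast
qed

section \<open>Subgroups of topological groups and their closures\<close>

lemma totally_disconnected_space_subtopology:
  "totally_disconnected_space T \<Longrightarrow> totally_disconnected_space (subtopology T U)"
  by (auto simp: totally_disconnected_space_def connectedin_subtopology)

lemma topological_group_subtopology:
  assumes G: "topological_group G T" and K: "subgroup K G"
  shows "topological_group (G\<lparr>carrier := K\<rparr>) (subtopology T K)"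
  unfolding topological_group_def
proof (intro conjI)
  interpret group G using G by (simp add: topological_group_def)
  have top: "topspace T = carrier G"
    and mult: "continuous_map (prod_topology T T) T (\<lambda>(x, y). x \<otimes>\<^bsub>G\<^esub> y)"
    and inv: "continuous_map T T (\<lambda>x. inv\<^bsub>G\<^esub> x)"
    using G by (auto simp: topological_group_def)
  have sub: "K \<subseteq> carrier G" using K by (rule subgroup.subset)
  show "group (G\<lparr>carrier := K\<rparr>)" using K by (rule subgroup_imp_group)
  show "topspace (subtopology T K) = carrier (G\<lparr>carrier := K\<rparr>)"
    using sub by (auto simp: top)
  have "continuous_map (subtopology (prod_topology T T) (K \<times> K)) (subtopology T K)
      (\<lambda>(x, y). x \<otimes>\<^bsub>G\<^esub> y)"
    using mult subgroup.m_closed[OF K]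
    by (auto simp: continuous_map_in_subtopology intro: continuous_map_from_subtopology)
  then show "continuous_map (prod_topology (subtopology T K) (subtopology T K)) (subtopology T K)
      (\<lambda>(x, y). x \<otimes>\<^bsub>G\<lparr>carrier := K\<rparr>\<^esub> y)"
    by (simp add: subtopology_Times)
  have "continuous_map (subtopology T K) (subtopology T K) (\<lambda>x. inv\<^bsub>G\<^esub> x)"
    using inv subgroup.m_inv_closed[OF K]
    by (auto simp: continuous_map_in_subtopology intro: continuous_map_from_subtopology)
  then show "continuous_map (subtopology T K) (subtopology T K) (\<lambda>x. inv\<^bsub>G\<lparr>carrier := K\<rparr>\<^esub> x)"
    by (rule continuous_map_eq) (use sub K in \<open>auto simp: top m_inv_consistent\<close>)
qed

text \<open>
  Because closure commutes with binary products, continuity of the multiplication on \<open>K \<times> K\<close>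
  already controls it on the product of the closures.
\<close>
lemma subgroup_closure_of:
  assumes G: "topological_group G T" and K: "subgroup K G"
  shows "subgroup (T closure_of K) G"
proof -
  interpret group G using G by (simp add: topological_group_def)
  have top: "topspace T = carrier G"
    and mult: "continuous_map (prod_topology T T) T (\<lambda>(x, y). x \<otimes>\<^bsub>G\<^esub> y)"
    and inv: "continuous_map T T (\<lambda>x. inv\<^bsub>G\<^esub> x)"
    using G by (auto simp: topological_group_def)
  have sub: "K \<subseteq> T closure_of K"
    using subgroup.subset[OF K] by (simp add: closure_of_subset top)
  show ?thesis
  proof (rule subgroupI)
    show "T closure_of K \<subseteq> carrier G" using closure_of_subset_topspace top by metis
    show "T closure_of K \<noteq> {}" using sub subgroup.one_closed[OF K] by blast
    have "(\<lambda>x. inv\<^bsub>G\<^esub> x) ` (T closure_of K) \<subseteq> T closure_of ((\<lambda>x. inv\<^bsub>G\<^esub> x) ` K)"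
      by (rule continuous_map_image_closure_subset[OF inv])
    also have "\<dots> \<subseteq> T closure_of K"
      by (rule closure_of_mono) (use subgroup.m_inv_closed[OF K] in blast)
    finally show "inv\<^bsub>G\<^esub> x \<in> T closure_of K" if "x \<in> T closure_of K" for x
      using that by blast
    have "(\<lambda>(x, y). x \<otimes>\<^bsub>G\<^esub> y) ` ((T closure_of K) \<times> (T closure_of K))
        \<subseteq> T closure_of ((\<lambda>(x, y). x \<otimes>\<^bsub>G\<^esub> y) ` (K \<times> K))"
      using continuous_map_image_closure_subset[OF mult, of "K \<times> K"]
      by (simp add: closure_of_Times)
    also have "\<dots> \<subseteq> T closure_of K"
      by (rule closure_of_mono) (use subgroup.m_closed[OF K] in auto)
    finally show "x \<otimes>\<^bsub>G\<^esub> y \<in> T closure_of K"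
      if "x \<in> T closure_of K" "y \<in> T closure_of K" for x y
      using that by blast
  qed
qed

section \<open>Local compactness of closures of permutation groups\<close>

text \<open>
  Read \<open>Q c\<close> as the orbit of \<open>c\<close> under a group with finite orbits.  By Tychonoff's theorem the
  product of the orbits is compact.  Injectivity is a closed condition on maps, whereas surjectivity
  need not survive limits; the finiteness of the blocks supplies it, because an injective self-map
  of a finite block is onto.
\<close>
lemma compactin_injections_preserving_finite_blocks:
  assumes fin: "\<And>c. c \<in> S \<Longrightarrow> finite (Q c)"
    and sub: "\<And>c. c \<in> S \<Longrightarrow> Q c \<subseteq> S"
    and self: "\<And>c. c \<in> S \<Longrightarrow> c \<in> Q c"
    and trans: "\<And>c d. c \<in> S \<Longrightarrow> d \<in> Q c \<Longrightarrow> Q d \<subseteq> Q c"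
  shows "compactin (sym_topology S) {x \<in> Bij S. \<forall>c\<in>S. x c \<in> Q c}"
proof -
  let ?P = "product_topology (\<lambda>_. discrete_topology S) S"
  let ?K = "{x \<in> PiE S Q. inj_on x S}"
  have Bij: "x \<in> Bij S" if x: "x \<in> ?K" for x
  proof -
    have xQ: "x c \<in> Q c" if "c \<in> S" for c using x that by auto
    have "c \<in> x ` S" if c: "c \<in> S" for c
    proof -
      have "x ` Q c \<subseteq> Q c"
        using xQ trans[OF c] sub[OF c] by blast
      moreover have "inj_on x (Q c)"
        using x sub[OF c] by (auto intro: inj_on_subset)
      ultimately have "x ` Q c = Q c" by (rule endo_inj_surj[OF fin[OF c]])
      then show ?thesis using self[OF c] sub[OF c] by blast
    qed
    moreover have "x ` S \<subseteq> S" using xQ sub by blast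
    ultimately show ?thesis
      using x by (auto simp: Bij_def bij_betw_def PiE_def)
  qed
  have K: "{x \<in> Bij S. \<forall>c\<in>S. x c \<in> Q c} = ?K"
    using Bij by (auto simp: PiE_def Bij_imp_extensional) (simp add: Bij_def bij_betw_def)
  have ext: "PiE S Q \<subseteq> topspace ?P"
    using sub by (auto simp: PiE_def Pi_def)
  have "compactin ?P (PiE S Q)"
    using fin sub by (simp add: compactin_PiE finite_imp_compactin)
  moreover have "closedin ?P (topspace ?P - (\<Union>c\<in>S. \<Union>d\<in>S - {c}. {x \<in> topspace ?P. x c = x d}))"
  proof (intro closedin_diff closedin_topspace openin_Union)
    fix A assume "A \<in> (\<lambda>c. \<Union>d\<in>S - {c}. {x \<in> topspace ?P. x c = x d}) ` S"
    then obtain c where c: "c \<in> S" "A = (\<Union>d\<in>S - {c}. {x \<in> topspace ?P. x c = x d})" by blast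
    have "openin ?P {x \<in> topspace ?P. x c = x d}" if d: "d \<in> S" for d
    proof -
      have proj: "openin ?P {x \<in> topspace ?P. x i \<in> {e}}" if "i \<in> S" "e \<in> S" for i e
        by (rule openin_continuous_map_preimage[OF continuous_map_product_projection]) (use that in auto)
      have "{x \<in> topspace ?P. x c = x d} =
          (\<Union>e\<in>S. {x \<in> topspace ?P. x c \<in> {e}} \<inter> {x \<in> topspace ?P. x d \<in> {e}})"
        using c d by auto
      also have "openin ?P \<dots>"
        by (rule openin_Union) (use proj c d in blast)
      finally show ?thesis .
    qed
    then show "openin ?P A" unfolding c by (intro openin_Union) blast
  qed
  ultimately have "compactin ?P (PiE S Q \<inter>
      (topspace ?P - (\<Union>c\<in>S. \<Union>d\<in>S - {c}. {x \<in> topspace ?P. x c = x d})))"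
    by (rule compact_Int_closedin)
  also have "PiE S Q \<inter>
      (topspace ?P - (\<Union>c\<in>S. \<Union>d\<in>S - {c}. {x \<in> topspace ?P. x c = x d})) = ?K"
    using ext by (auto simp: inj_on_def)
  finally have "compactin ?P ?K" .
  then show ?thesis
    unfolding K sym_topology_eq_subtopology_product using Bij by (auto simp: compactin_subtopology)
qed

text \<open>
  Let \<open>C\<close> be the closure of \<open>\<Gamma>\<close>.  The stabilizer of \<open>b\<close> in \<open>C\<close> is open, and each of its elements agrees
  at any prescribed point with an element of the stabilizer of \<open>b\<close> in \<open>\<Gamma>\<close>.  It is therefore a closed
  set of permutations preserving the finite orbits of the latter, hence compact.  Its translates
  are compact open neighbourhoods of all the other points of \<open>C\<close>.
\<close>
lemma locally_compact_space_closure_of_permutations: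
  assumes G: "subgroup \<Gamma> (BijGroup S)" and b: "b \<in> S"
    and fin: "\<And>c. c \<in> S \<Longrightarrow> finite {x c | x. x \<in> \<Gamma> \<and> x b = b}"
  shows "locally_compact_space (subtopology (sym_topology S) (sym_topology S closure_of \<Gamma>))"
proof -
  let ?T = "sym_topology S" and ?B = "BijGroup S"
  let ?C = "?T closure_of \<Gamma>"
  interpret B: group ?B by (rule group_BijGroup)
  have tg: "topological_group ?B ?T" by (rule topological_group_sym_topology)
  have C: "subgroup ?C ?B" by (rule subgroup_closure_of[OF tg G])
  have CB: "?C \<subseteq> Bij S" using subgroup.subset[OF C] by (simp add: carrier_BijGroup)
  have GB: "\<Gamma> \<subseteq> Bij S" using subgroup.subset[OF G] by (simp add: carrier_BijGroup)
  define Q where "Q c = {x c | x. x \<in> \<Gamma> \<and> x b = b}" for c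
  have K: "compactin ?T {x \<in> Bij S. \<forall>c\<in>S. x c \<in> Q c}"
  proof (rule compactin_injections_preserving_finite_blocks)
    fix c assume c: "c \<in> S"
    show "finite (Q c)" unfolding Q_def by (rule fin[OF c])
    show "Q c \<subseteq> S" unfolding Q_def using Bij_apply[OF _ c] GB by auto
    show "c \<in> Q c"
      unfolding Q_def mem_Collect_eq
      using subgroup.one_closed[OF G] one_BijGroup_apply[OF b] one_BijGroup_apply[OF c, symmetric]
      by blast
    fix d assume "d \<in> Q c"
    then obtain x where x: "x \<in> \<Gamma>" "x b = b" "d = x c" unfolding Q_def by blast
    show "Q d \<subseteq> Q c"
    proof
      fix e assume "e \<in> Q d"
      then obtain y where y: "y \<in> \<Gamma>" "y b = b" "e = y d" unfolding Q_def by blast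
      have "y \<otimes>\<^bsub>?B\<^esub> x \<in> \<Gamma>" by (rule subgroup.m_closed[OF G y(1) x(1)])
      moreover have "(y \<otimes>\<^bsub>?B\<^esub> x) z = y (x z)" if "z \<in> S" for z
        by (rule mult_BijGroup_apply) (use x(1) y(1) GB that in auto)
      then have "(y \<otimes>\<^bsub>?B\<^esub> x) b = b" "e = (y \<otimes>\<^bsub>?B\<^esub> x) c"
        using x(2,3) y(2,3) b c by auto
      ultimately show "e \<in> Q c" unfolding Q_def by blast
    qed
  qed
  have cl: "closedin ?T ({x \<in> Bij S. x b = b} \<inter> ?C)"
    using clopen_sym_topology_eval(2)[OF b] by (intro closedin_Int closedin_closure_of)
  have orb: "x c \<in> Q c" if x: "x \<in> ?C" "x b = b" and c: "c \<in> S" for x c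
  proof -
    \<comment> \<open>approximate \<open>x\<close> at the two points \<open>b\<close> and \<open>c\<close> by an element of \<open>\<Gamma>\<close>\<close>
    let ?N = "{y \<in> Bij S. y b = x b} \<inter> {y \<in> Bij S. y c = x c}"
    have "openin ?T ?N"
      by (intro openin_Int clopen_sym_topology_eval(1) b c)
    moreover have "x \<in> ?N" using x CB by auto
    ultimately have "\<exists>y. y \<in> \<Gamma> \<and> y \<in> ?N"
      using x(1) unfolding in_closure_of by (elim conjE allE[of _ ?N]) simp
    then obtain y where "y \<in> \<Gamma>" "y \<in> ?N" by blast
    then have "x c = y c" "y \<in> \<Gamma>" "y b = b" using x(2) by auto
    then show ?thesis unfolding Q_def by blast
  qed
  have sub: "{x \<in> Bij S. x b = b} \<inter> ?C \<subseteq> {x \<in> Bij S. \<forall>c\<in>S. x c \<in> Q c}"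
    using orb by auto
  have U: "compactin ?T ({x \<in> Bij S. x b = b} \<inter> ?C)"
    by (rule closed_compactin[OF K sub cl])
  show ?thesis
    unfolding locally_compact_space_def
  proof
    fix x assume "x \<in> topspace (subtopology ?T ?C)"
    then have x: "x \<in> ?C" and xB: "x \<in> Bij S" using CB by auto
    let ?W = "{y \<in> Bij S. y b = x b} \<inter> ?C"
    let ?K = "(\<lambda>y. x \<otimes>\<^bsub>?B\<^esub> y) ` ({y \<in> Bij S. y b = b} \<inter> ?C)"
    have "continuous_map ?T ?T ((\<lambda>(x, y). x \<otimes>\<^bsub>?B\<^esub> y) \<circ> (\<lambda>y. (x, y)))"
    proof (rule continuous_map_compose)
      show "continuous_map ?T (prod_topology ?T ?T) (\<lambda>y. (x, y))"
        using xB by (simp add: continuous_map_pairedI topspace_sym_topology)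
      show "continuous_map (prod_topology ?T ?T) ?T (\<lambda>(x, y). x \<otimes>\<^bsub>?B\<^esub> y)"
        using tg by (simp add: topological_group_def)
    qed
    then have "compactin ?T ?K"
      using image_compactin[OF U] by (simp add: o_def)
    moreover have "?K \<subseteq> ?C" using subgroup.m_closed[OF C x] by blast
    ultimately have "compactin (subtopology ?T ?C) ?K"
      by (simp add: compactin_subtopology)
    moreover have "openin (subtopology ?T ?C) ?W"
      unfolding openin_subtopology using clopen_sym_topology_eval(1)[OF b] by blast
    moreover have "?W \<subseteq> ?K"
    proof
      fix y assume y: "y \<in> ?W"
      let ?z = "inv\<^bsub>?B\<^esub> x \<otimes>\<^bsub>?B\<^esub> y"
      have ix: "inv\<^bsub>?B\<^esub> x \<in> ?C" by (rule subgroup.m_inv_closed[OF C x])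
      then have z: "?z \<in> ?C" using y by (auto intro: subgroup.m_closed[OF C])
      have "?z b = (inv\<^bsub>?B\<^esub> x) (y b)"
        using ix y CB b by (intro mult_BijGroup_apply) auto
      also have "\<dots> = b"
        using inv_BijGroup_apply_eq[OF xB Bij_apply[OF xB b] b] y by auto
      finally have "?z b = b" .
      moreover have "y = x \<otimes>\<^bsub>?B\<^esub> ?z"
      proof -
        have xy: "x \<in> carrier ?B" "y \<in> carrier ?B" using xB y by (auto simp: carrier_BijGroup)
        then have "x \<otimes>\<^bsub>?B\<^esub> ?z = (x \<otimes>\<^bsub>?B\<^esub> inv\<^bsub>?B\<^esub> x) \<otimes>\<^bsub>?B\<^esub> y"
          by (intro B.m_assoc[symmetric] B.inv_closed)
        then show ?thesis using xy by simp
      qed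
      ultimately show "y \<in> ?K" using z CB by blast
    qed
    ultimately show "\<exists>U K. openin (subtopology ?T ?C) U \<and> compactin (subtopology ?T ?C) K \<and> x \<in> U \<and> U \<subseteq> K"
      using x xB by (intro exI[of _ ?W] exI[of _ ?K]) auto
  qed
qed

section \<open>The action of a group on left cosets\<close>

definition coset_action :: "('a, 'b) monoid_scheme \<Rightarrow> 'a set \<Rightarrow> 'a \<Rightarrow> 'a set \<Rightarrow> 'a set"
  where "coset_action G H g = (\<lambda>C\<in>lcosets\<^bsub>G\<^esub> H. g <#\<^bsub>G\<^esub> C)"

context group
begin

lemma lcosetsI: "g \<in> carrier G \<Longrightarrow> g <# H \<in> lcosets H"
  by (auto simp: LCOSETS_def)

lemma lcosetsE:
  assumes "C \<in> lcosets H" obtains g where "g \<in> carrier G" "C = g <# H"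
  using assms by (auto simp: LCOSETS_def)

lemma coset_action_apply:
  assumes "subgroup H G" "g \<in> carrier G" "h \<in> carrier G"
  shows "coset_action G H g (h <# H) = (g \<otimes> h) <# H"
  using assms by (simp add: coset_action_def lcosetsI lcos_m_assoc subgroup.subset)

lemma coset_action_one_coset:
  assumes "subgroup H G" "g \<in> carrier G"
  shows "coset_action G H g H = g <# H"
  using coset_action_apply[OF assms one_closed] assms by (simp add: lcos_mult_one subgroup.subset)

lemma coset_action_in_Bij:
  assumes H: "subgroup H G" and g: "g \<in> carrier G"
  shows "coset_action G H g \<in> Bij (lcosets H)"
proof -
  have act: "coset_action G H x C \<in> lcosets H \<and>
      coset_action G H (inv x) (coset_action G H x C) = C"
    if "x \<in> carrier G" "C \<in> lcosets H" for x C
    using that H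
    by (elim lcosetsE) (simp add: coset_action_apply lcosetsI flip: m_assoc)
  have "bij_betw (coset_action G H g) (lcosets H) (lcosets H)"
    by (rule bij_betw_byWitness[where f' = "coset_action G H (inv g)"])
       (use act[OF g] act[OF inv_closed[OF g]] g in auto)
  then show ?thesis by (simp add: Bij_def coset_action_def)
qed

lemma coset_action_hom:
  assumes H: "subgroup H G"
  shows "coset_action G H \<in> hom G (BijGroup (lcosets H))"
proof (rule homI)
  show "coset_action G H g \<in> carrier (BijGroup (lcosets H))" if "g \<in> carrier G" for g
    using coset_action_in_Bij[OF H that] by (simp add: carrier_BijGroup)
  fix g h assume gh: "g \<in> carrier G" "h \<in> carrier G"
  let ?B = "BijGroup (lcosets H)"
  have Bij: "coset_action G H g \<in> Bij (lcosets H)" "coset_action G H h \<in> Bij (lcosets H)"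
    using gh coset_action_in_Bij[OF H] by auto
  show "coset_action G H (g \<otimes> h) = coset_action G H g \<otimes>\<^bsub>?B\<^esub> coset_action G H h"
  proof (rule extensionalityI)
    show "coset_action G H (g \<otimes> h) \<in> extensional (lcosets H)"
      by (simp add: coset_action_def)
    show "coset_action G H g \<otimes>\<^bsub>?B\<^esub> coset_action G H h \<in> extensional (lcosets H)"
      using Bij by (simp add: BijGroup_def compose_def)
    fix C assume C: "C \<in> lcosets H"
    then show "coset_action G H (g \<otimes> h) C = (coset_action G H g \<otimes>\<^bsub>?B\<^esub> coset_action G H h) C"
      using gh H by (subst mult_BijGroup_apply[OF Bij C], elim lcosetsE)
        (simp add: coset_action_apply m_assoc)
  qed
qed

lemma lcoset_eq_self_iff:
  assumes "subgroup H G" "g \<in> carrier G"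
  shows "g <# H = H \<longleftrightarrow> g \<in> H"
  using assms lcos_self[of g H] coset_join3[of g H] by blast

lemma normal_kernel_coset_action:
  assumes H: "subgroup H G"
  shows "kernel G (BijGroup (lcosets H)) (coset_action G H) \<lhd> G"
  using group_hom.normal_kernel[of G "BijGroup (lcosets H)" "coset_action G H"]
    coset_action_hom[OF H] group_BijGroup[of "lcosets H"]
  by (simp add: group_hom_def group_hom_axioms_def is_group)

text \<open>
  The stabilizer of the base coset \<open>H\<close> is \<open>H\<close> itself.
\<close>
lemma kernel_coset_action_subset:
  assumes H: "subgroup H G"
  shows "kernel G (BijGroup (lcosets H)) (coset_action G H) \<subseteq> H"
proof
  fix g assume "g \<in> kernel G (BijGroup (lcosets H)) (coset_action G H)"
  then have g: "g \<in> carrier G" "coset_action G H g = \<one>\<^bsub>BijGroup (lcosets H)\<^esub>"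
    by (auto simp: kernel_def)
  have "H \<in> lcosets H"
    using lcosetsI[OF one_closed, of H] H by (simp add: lcos_mult_one subgroup.subset)
  then have "g <# H = H"
    using g coset_action_one_coset[OF H g(1)] one_BijGroup_apply by metis
  then show "g \<in> H" using lcoset_eq_self_iff[OF H g(1)] by simp
qed

subsection \<open>Cyclic subgroups\<close>

text \<open>
  The equation \<open>x \<otimes> g = g \<otimes> y\<close> is the conjugacy \<open>y = inv g \<otimes> x \<otimes> g\<close> with the inverse cleared,
  a form that can be iterated and composed by reassociating alone.
\<close>
lemma intertwine_nat_pow:
  assumes "x \<in> carrier G" "y \<in> carrier G" "g \<in> carrier G" "x \<otimes> g = g \<otimes> y"
  shows "x [^] (j::nat) \<otimes> g = g \<otimes> y [^] j"
proof (induction j)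
  case (Suc j)
  have "x [^] Suc j \<otimes> g = x [^] j \<otimes> (x \<otimes> g)" using assms by (simp add: m_assoc)
  also have "\<dots> = (x [^] j \<otimes> g) \<otimes> y" using assms by (simp add: m_assoc)
  also have "\<dots> = g \<otimes> y [^] Suc j" using assms by (simp add: Suc.IH m_assoc)
  finally show ?case .
qed (use assms in simp)

lemma intertwine_inv:
  assumes "x \<in> carrier G" "y \<in> carrier G" "g \<in> carrier G" "x \<otimes> g = g \<otimes> y"
  shows "inv x \<otimes> g = g \<otimes> inv y"
proof -
  have "inv x \<otimes> g = inv x \<otimes> (g \<otimes> y) \<otimes> inv y" using assms(1-3) by (simp add: m_assoc)
  also have "\<dots> = g \<otimes> inv y" using assms(1-3) by (simp add: m_assoc[symmetric] flip: assms(4))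
  finally show ?thesis .
qed

lemma intertwine_inv_right:
  assumes "x \<in> carrier G" "y \<in> carrier G" "g \<in> carrier G" "x \<otimes> g = g \<otimes> y"
  shows "y \<otimes> inv g = inv g \<otimes> x"
proof -
  have "y \<otimes> inv g = inv g \<otimes> (g \<otimes> y) \<otimes> inv g" using assms(1-3) by (simp add: m_assoc[symmetric])
  also have "\<dots> = inv g \<otimes> x" using assms(1-3) by (simp add: m_assoc flip: assms(4))
  finally show ?thesis .
qed

lemma intertwine_int_pow:
  assumes "x \<in> carrier G" "y \<in> carrier G" "g \<in> carrier G" "x \<otimes> g = g \<otimes> y"
  shows "x [^] (j::int) \<otimes> g = g \<otimes> y [^] j"
proof (cases "j < 0")
  case True
  have "inv (x [^] nat (- j)) \<otimes> g = g \<otimes> inv (y [^] nat (- j))"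
    using assms(1-3) intertwine_nat_pow[OF assms] by (intro intertwine_inv) auto
  with True show ?thesis by (simp only: int_pow_def2 if_True)
next
  case False
  then show ?thesis using intertwine_nat_pow[OF assms] by (simp only: int_pow_def2 if_False)
qed

text \<open>
  The elements that conjugate some non-trivial power of \<open>a\<close> to a non-trivial power of \<open>a\<close>: for \<open>a\<close> of
  infinite order this is the commensurator of \<open>\<langle>a\<rangle>\<close>.  Being a subgroup, it can be shown to be the
  whole group by looking at generators only.
\<close>
lemma subgroup_commensurator_cyclic:
  assumes a: "a \<in> carrier G"
  shows "subgroup {g \<in> carrier G. \<exists>(k::int) (l::int). k \<noteq> 0 \<and> l \<noteq> 0 \<and> a [^] k \<otimes> g = g \<otimes> a [^] l} G"
    (is "subgroup ?K G")
proof (rule subgroupI)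
  show "?K \<subseteq> carrier G" by blast
  have "a [^] (1::int) \<otimes> \<one> = \<one> \<otimes> a [^] (1::int)"
    using a by (simp only: int_pow_closed l_one r_one)
  then have "\<exists>(k::int) (l::int). k \<noteq> 0 \<and> l \<noteq> 0 \<and> a [^] k \<otimes> \<one> = \<one> \<otimes> a [^] l"
    by (intro exI[of _ "1::int"] conjI) simp_all
  then have "\<one> \<in> ?K" by simp
  then show "?K \<noteq> {}" by blast
next
  fix g assume "g \<in> ?K"
  then obtain k l :: int where kl: "k \<noteq> 0" "l \<noteq> 0" and g: "g \<in> carrier G"
    and eq: "a [^] k \<otimes> g = g \<otimes> a [^] l" by blast
  have "a [^] l \<otimes> inv g = inv g \<otimes> a [^] k"
    using a g eq by (intro intertwine_inv_right) auto
  then have "\<exists>(k::int) (l::int). k \<noteq> 0 \<and> l \<noteq> 0 \<and> a [^] k \<otimes> inv g = inv g \<otimes> a [^] l"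
    using kl by blast
  then show "inv g \<in> ?K" using g by simp
next
  fix g h assume "g \<in> ?K" "h \<in> ?K"
  then obtain k l k' l' :: int where kl: "k \<noteq> 0" "l \<noteq> 0" "k' \<noteq> 0" "l' \<noteq> 0"
    and g: "g \<in> carrier G" "a [^] k \<otimes> g = g \<otimes> a [^] l"
    and h: "h \<in> carrier G" "a [^] k' \<otimes> h = h \<otimes> a [^] l'" by blast
  have 1: "a [^] (k * k') \<otimes> g = g \<otimes> a [^] (l * k')"
    using intertwine_int_pow[OF _ _ g, of k'] a by (simp add: int_pow_pow)
  have 2: "a [^] (l * k') \<otimes> h = h \<otimes> a [^] (l * l')"
    using intertwine_int_pow[OF _ _ h, of l] a by (simp add: int_pow_pow mult.commute)
  have "a [^] (k * k') \<otimes> (g \<otimes> h) = (g \<otimes> a [^] (l * k')) \<otimes> h"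
    using a g(1) h(1) by (simp add: 1 flip: m_assoc)
  also have "\<dots> = (g \<otimes> h) \<otimes> a [^] (l * l')"
    using a g(1) h(1) by (simp add: 2 m_assoc)
  finally have "a [^] (k * k') \<otimes> (g \<otimes> h) = (g \<otimes> h) \<otimes> a [^] (l * l')" .
  moreover have "k * k' \<noteq> 0" "l * l' \<noteq> 0" using kl by auto
  ultimately have "\<exists>(k::int) (l::int). k \<noteq> 0 \<and> l \<noteq> 0 \<and> a [^] k \<otimes> (g \<otimes> h) = (g \<otimes> h) \<otimes> a [^] l"
    by blast
  then show "g \<otimes> h \<in> ?K" using g(1) h(1) by simp
qed

text \<open>
  The power \<open>a [^] k\<close> fixes the coset of \<open>g\<close>, so the orbit of that coset under \<open>\<langle>a\<rangle>\<close> is already obtained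
  from exponents modulo \<open>k\<close>.
\<close>
lemma finite_cyclic_orbit_on_cosets:
  assumes a: "a \<in> carrier G" and g: "g \<in> carrier G"
    and k: "k \<noteq> (0::int)" and eq: "a [^] k \<otimes> g = g \<otimes> a [^] (l::int)"
  shows "finite {(h \<otimes> g) <# generate G {a} | h. h \<in> generate G {a}}"
proof -
  let ?H = "generate G {a}"
  have H: "subgroup ?H G" using a by (simp add: generate_is_subgroup)
  have "(a [^] i \<otimes> g) <# ?H \<in> (\<lambda>r. (a [^] r \<otimes> g) <# ?H) ` {- \<bar>k\<bar>..\<bar>k\<bar>}" for i :: int
  proof -
    have "a [^] i \<otimes> g = a [^] (i mod k) \<otimes> ((a [^] k) [^] (i div k) \<otimes> g)"
      using a g by (simp add: int_pow_pow int_pow_mult flip: m_assoc int_pow_mult)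
    also have "\<dots> = (a [^] (i mod k) \<otimes> g) \<otimes> a [^] (l * (i div k))"
      using a g by (subst intertwine_int_pow[OF _ _ g eq]) (simp_all add: int_pow_pow m_assoc)
    finally have "(a [^] i \<otimes> g) <# ?H
        = (a [^] (i mod k) \<otimes> g) <# (a [^] (l * (i div k)) <# ?H)"
      using a g subgroup.subset[OF H] by (simp add: lcos_m_assoc)
    also have "a [^] (l * (i div k)) <# ?H = ?H"
      using a generate_pow[OF a] by (subst lcoset_eq_self_iff[OF H]) auto
    finally have "(a [^] i \<otimes> g) <# ?H = (a [^] (i mod k) \<otimes> g) <# ?H" .
    \<comment> \<open>the remainder takes the sign of \<open>k\<close>, whence the two-sided interval\<close>
    moreover have "i mod k \<in> {- \<bar>k\<bar>..\<bar>k\<bar>}"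
      using k abs_mod_less[of k i] by auto
    ultimately show ?thesis by blast
  qed
  then have "{(h \<otimes> g) <# ?H | h. h \<in> ?H} \<subseteq> (\<lambda>r. (a [^] r \<otimes> g) <# ?H) ` {- \<bar>k\<bar>..\<bar>k\<bar>}"
    using generate_pow[OF a] by auto
  then show ?thesis by (rule finite_subset) simp
qed

text \<open>
  Conjugation by \<open>t\<close> sends \<open>a [^] k\<close> to some \<open>a [^] j\<close> that is again in \<open>N\<close>.  Taking \<open>m\<close>-th powers turns the
  relation into \<open>j * m = n * k\<close>, and minimality of \<open>k\<close> gives \<open>\<bar>k\<bar> \<le> \<bar>j\<bar>\<close>.
\<close>
lemma least_exponent_in_normal_subgroup:
  fixes k m n :: int
  assumes a: "a \<in> carrier G" and t: "t \<in> carrier G"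
    and inf: "\<And>i::int. a [^] i = \<one> \<Longrightarrow> i = 0"
    and rel: "a [^] n \<otimes> t = t \<otimes> a [^] m" and n: "n \<noteq> 0"
    and N: "N \<lhd> G" "N \<subseteq> generate G {a}"
    and k: "k \<noteq> 0" "a [^] k \<in> N"
    and least: "\<And>i::int. i \<noteq> 0 \<Longrightarrow> a [^] i \<in> N \<Longrightarrow> \<bar>k\<bar> \<le> \<bar>i\<bar>"
  shows "\<bar>m\<bar> \<le> \<bar>n\<bar>"
proof -
  have inj: "i = j" if "a [^] i = a [^] j" for i j :: int
    using inf[of "i - j"] that a by (simp add: int_pow_diff)
  have "t \<otimes> a [^] k \<otimes> inv t \<in> N"
    using normal.inv_op_closed2[OF N(1) t k(2)] .
  moreover from this obtain j :: int where j: "t \<otimes> a [^] k \<otimes> inv t = a [^] j"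
    using N(2) generate_pow[OF a] by auto
  ultimately have jN: "a [^] j \<in> N" by simp
  have "a [^] j \<otimes> t = t \<otimes> a [^] k"
    using a t by (simp add: m_assoc flip: j)
  then have "(a [^] j) [^] m \<otimes> t = t \<otimes> (a [^] k) [^] m"
    using a t by (intro intertwine_int_pow) auto
  also have "\<dots> = (a [^] n) [^] k \<otimes> t"
    using intertwine_int_pow[OF _ _ t rel, of k] a by (simp add: int_pow_pow mult.commute)
  finally have jm: "j * m = n * k"
    using a t by (intro inj) (simp add: int_pow_pow)
  then have "j \<noteq> 0" using n k(1) by auto
  then have "\<bar>m\<bar> * \<bar>k\<bar> \<le> \<bar>m\<bar> * \<bar>j\<bar>" using least[OF _ jN] by (simp add: mult_left_mono)
  also have "\<dots> = \<bar>n\<bar> * \<bar>k\<bar>" using jm by (simp add: mult.commute flip: abs_mult)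
  finally show "\<bar>m\<bar> \<le> \<bar>n\<bar>" using k(1) by simp
qed

text \<open>
  Applied to \<open>t\<close> and to its inverse, which exchanges \<open>m\<close> and \<open>n\<close>, the preceding inequality forces
  \<open>\<bar>m\<bar> = \<bar>n\<bar>\<close> as soon as \<open>N\<close> contains a non-trivial power of \<open>a\<close>.
\<close>
lemma trivial_normal_subgroup_of_cyclic:
  fixes m n :: int
  assumes a: "a \<in> carrier G" and t: "t \<in> carrier G"
    and inf: "\<And>i::int. a [^] i = \<one> \<Longrightarrow> i = 0"
    and rel: "a [^] n \<otimes> t = t \<otimes> a [^] m"
    and mn: "m \<noteq> 0" "n \<noteq> 0" "\<bar>m\<bar> \<noteq> \<bar>n\<bar>"
    and N: "N \<lhd> G" "N \<subseteq> generate G {a}"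
  shows "N = {\<one>}"
proof (rule ccontr)
  assume "N \<noteq> {\<one>}"
  moreover have "\<one> \<in> N" using N(1) by (simp add: normal_imp_subgroup subgroup.one_closed)
  ultimately obtain x where "x \<in> N" "x \<noteq> \<one>" by blast
  then obtain i :: int where "x = a [^] i" using N(2) generate_pow[OF a] by auto
  with \<open>x \<in> N\<close> \<open>x \<noteq> \<one>\<close> have "i \<noteq> 0 \<and> a [^] i \<in> N" by auto
  then obtain k :: int where k: "k \<noteq> 0" "a [^] k \<in> N"
    and least: "\<And>i::int. i \<noteq> 0 \<Longrightarrow> a [^] i \<in> N \<Longrightarrow> \<bar>k\<bar> \<le> \<bar>i\<bar>"
    using ex_has_least_nat[of "\<lambda>i. i \<noteq> 0 \<and> a [^] i \<in> N" i "\<lambda>i. nat \<bar>i\<bar>"]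
    by (metis abs_ge_zero nat_le_eq_zle zero_le_imp_eq_int nat_le_iff nat_eq_iff2)
  have "a [^] m \<otimes> inv t = inv t \<otimes> a [^] n"
    using a t rel by (intro intertwine_inv_right) auto
  from least_exponent_in_normal_subgroup[OF a inv_closed[OF t] inf this mn(1) N k least]
    least_exponent_in_normal_subgroup[OF a t inf rel mn(2) N k least] mn(3)
  show False by linarith
qed

end

section \<open>Powers, generation and actions of presented groups\<close>

lemma presented_group_one: "\<one>\<^bsub>presented_group R\<^esub> = word_class R []"
  by (simp add: presented_group_def)

lemma word_class_closed: "word_class R u \<in> carrier (presented_group R)"
  by (simp add: presented_group_def)

lemma presented_group_inv_generator:
  "inv\<^bsub>presented_group R\<^esub> (word_class R [(x, True)]) = word_class R [(x, False)]"
proof (rule group.inv_equality[OF group_presented_group])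
  have "word_eq R ([] @ [(x, False), (x, \<not> False)] @ []) ([] @ [])" by (rule word_eq.cancel)
  then show "word_class R [(x, False)] \<otimes>\<^bsub>presented_group R\<^esub> word_class R [(x, True)]
      = \<one>\<^bsub>presented_group R\<^esub>"
    by (simp add: presented_group_mult presented_group_one word_class_eq_iff)
qed (rule word_class_closed)+

lemma presented_group_nat_pow:
  "word_class R [p] [^]\<^bsub>presented_group R\<^esub> (k::nat) = word_class R (replicate k p)"
proof (induction k)
  case 0
  interpret group "presented_group R" by (rule group_presented_group)
  show ?case by (simp add: presented_group_one)
next
  case (Suc k)
  interpret group "presented_group R" by (rule group_presented_group)
  show ?case
    by (simp add: Suc.IH presented_group_mult replicate_append_same)
qed

lemma presented_group_int_pow:
  "word_class R [(x, True)] [^]\<^bsub>presented_group R\<^esub> (k::int) = word_class R (word_power x k)"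
proof -
  interpret group "presented_group R" by (rule group_presented_group)
  have "inv\<^bsub>presented_group R\<^esub> (word_class R [(x, True)] [^]\<^bsub>presented_group R\<^esub> j)
      = word_class R (replicate j (x, False))" for j :: nat
    unfolding nat_pow_inv[OF word_class_closed, symmetric]
    by (simp only: presented_group_inv_generator presented_group_nat_pow)
  then show ?thesis
    by (simp add: int_pow_def2 word_power_def presented_group_nat_pow)
qed

lemma carrier_presented_group_subset:
  assumes K: "subgroup K (presented_group R)" and gen: "\<And>x. word_class R [(x, True)] \<in> K"
  shows "carrier (presented_group R) \<subseteq> K"
proof -
  have "word_class R w \<in> K" for w
  proof (induction w)
    case Nil
    show ?case using subgroup.one_closed[OF K] by (simp add: presented_group_one)
  next
    case (Cons p w)
    obtain x b where p: "p = (x, b)" by (cases p)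
    have "word_class R [p] \<in> K"
      using gen[of x] subgroup.m_inv_closed[OF K gen[of x]] presented_group_inv_generator[of R x]
      by (cases b) (simp_all add: p)
    then have "word_class R [p] \<otimes>\<^bsub>presented_group R\<^esub> word_class R w \<in> K"
      using Cons.IH by (rule subgroup.m_closed[OF K])
    then show ?case by (simp add: presented_group_mult)
  qed
  then show ?thesis by (auto simp: presented_group_def)
qed

definition eval_word :: "('g \<times> bool \<Rightarrow> 'x \<Rightarrow> 'x) \<Rightarrow> 'g word \<Rightarrow> 'x \<Rightarrow> 'x"
  where "eval_word \<phi> w = foldr (\<lambda>p f. \<phi> p \<circ> f) w id"

lemma eval_word_Cons: "eval_word \<phi> (p # w) x = \<phi> p (eval_word \<phi> w x)"
  and eval_word_Nil: "eval_word \<phi> [] x = x"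
  by (simp_all add: eval_word_def)

lemma eval_word_append: "eval_word \<phi> (u @ v) x = eval_word \<phi> u (eval_word \<phi> v x)"
  by (induction u) (simp_all add: eval_word_Cons eval_word_Nil)

text \<open>
  The universal property of a presentation, for actions: letters acting by mutually inverse maps
  that satisfy the relations give an action of the presented group.
\<close>
lemma eval_word_cong:
  assumes "word_eq R u v"
    and "\<And>p b x. \<phi> (p, b) (\<phi> (p, \<not> b) x) = x"
    and "\<And>u v x. (u, v) \<in> R \<Longrightarrow> eval_word \<phi> u x = eval_word \<phi> v x"
  shows "eval_word \<phi> u x = eval_word \<phi> v x"
  using assms(1)
  by (induction arbitrary: x)
     (simp_all add: eval_word_append eval_word_Cons eval_word_Nil assms(2,3))

section \<open>Baumslag--Solitar groups\<close>

text \<open>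
  The action of the Baumslag--Solitar group on the real line by affine maps: \<open>a\<close> translates by one and
  \<open>t\<close> multiplies by \<open>q\<close>.  Conjugating the translation by \<open>m\<close> yields the translation by \<open>q * m\<close>, so the
  defining relation holds for \<open>q = n / m\<close>.
\<close>
fun affine_letter :: "real \<Rightarrow> bs_gen \<times> bool \<Rightarrow> real \<Rightarrow> real"
  where "affine_letter q (Gen_a, b) x = (if b then x + 1 else x - 1)"
  | "affine_letter q (Gen_t, b) x = (if b then q * x else x / q)"

lemma eval_affine_word_power_a:
  "eval_word (affine_letter q) (word_power Gen_a k) x = x + of_int k"
proof -
  have "eval_word (affine_letter q) (replicate j (Gen_a, b)) x = (if b then x + of_nat j else x - of_nat j)"
    for j b by (induction j) (auto simp: eval_word_Cons eval_word_Nil)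
  then show ?thesis by (simp add: word_power_def)
qed

lemma eval_affine_cong:
  assumes m: "m \<noteq> 0" and n: "n \<noteq> 0" and eq: "word_eq (BS_relations m n) u v"
  shows "eval_word (affine_letter (of_int n / of_int m)) u x
       = eval_word (affine_letter (of_int n / of_int m)) v x"
proof (rule eval_word_cong[OF eq])
  let ?q = "of_int n / of_int m :: real"
  show "affine_letter ?q (p, b) (affine_letter ?q (p, \<not> b) x) = x" for p b x
    using m n by (cases p) auto
  fix u v :: "bs_gen word" and x :: real assume uv: "(u, v) \<in> BS_relations m n"
  have "eval_word (affine_letter ?q) (word_power Gen_t 1) y = ?q * y"
    "eval_word (affine_letter ?q) (word_power Gen_t (- 1)) y = y / ?q" for y
    by (simp_all add: word_power_def eval_word_Cons eval_word_Nil)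
  then have "eval_word (affine_letter ?q) u x = ?q * (x / ?q + of_int m)"
    using uv by (simp add: BS_relations_def eval_word_append eval_affine_word_power_a)
  also have "\<dots> = x + of_int n" using m n by (simp add: field_simps)
  also have "\<dots> = eval_word (affine_letter ?q) v x"
    using uv by (simp add: BS_relations_def eval_affine_word_power_a)
  finally show "eval_word (affine_letter ?q) u x = eval_word (affine_letter ?q) v x" .
qed

lemma group_BS: "group (BS m n)"
  unfolding BS_def by (rule group_presented_group)

lemma BS_a_closed: "BS_a m n \<in> carrier (BS m n)"
  by (simp add: BS_a_def BS_def word_class_closed)

lemma BS_a_int_pow:
  "BS_a m n [^]\<^bsub>BS m n\<^esub> (k::int) = word_class (BS_relations m n) (word_power Gen_a k)"
proof -
  have "BS_a m n = word_class (BS_relations m n) [(Gen_a, True)]"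
    by (simp add: BS_a_def word_power_def)
  then show ?thesis by (simp add: BS_def presented_group_int_pow)
qed

text \<open>
  In the affine action, \<open>a [^] k\<close> moves the origin to \<open>k\<close>.
\<close>
lemma BS_a_infinite_order:
  assumes "m \<noteq> 0" "n \<noteq> 0" "BS_a m n [^]\<^bsub>BS m n\<^esub> (k::int) = \<one>\<^bsub>BS m n\<^esub>"
  shows "k = 0"
proof -
  have "word_eq (BS_relations m n) (word_power Gen_a k) []"
    using assms(3) unfolding BS_a_int_pow by (simp add: BS_def presented_group_one word_class_eq_iff)
  from eval_affine_cong[OF assms(1,2) this, of 0] show ?thesis
    by (simp add: eval_affine_word_power_a eval_word_Nil)
qed

lemma BS_relation:
  fixes m n :: int
  defines "t \<equiv> word_class (BS_relations m n) [(Gen_t, True)]"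
  shows "BS_a m n [^]\<^bsub>BS m n\<^esub> n \<otimes>\<^bsub>BS m n\<^esub> t = t \<otimes>\<^bsub>BS m n\<^esub> BS_a m n [^]\<^bsub>BS m n\<^esub> m"
proof -
  let ?R = "BS_relations m n"
  interpret group "BS m n" by (rule group_BS)
  have t: "t \<in> carrier (BS m n)" by (simp add: t_def BS_def word_class_closed)
  have "word_eq ?R ([] @ (word_power Gen_t 1 @ word_power Gen_a m @ word_power Gen_t (- 1)) @ [])
      ([] @ word_power Gen_a n @ [])"
    by (rule word_eq.relation) (simp add: BS_relations_def)
  then have "word_class ?R (word_power Gen_t 1 @ word_power Gen_a m @ word_power Gen_t (- 1))
      = word_class ?R (word_power Gen_a n)"
    by (simp add: word_class_eq_iff)
  then have "t \<otimes>\<^bsub>BS m n\<^esub> (BS_a m n [^]\<^bsub>BS m n\<^esub> m \<otimes>\<^bsub>BS m n\<^esub> inv\<^bsub>BS m n\<^esub> t)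
      = BS_a m n [^]\<^bsub>BS m n\<^esub> n"
    unfolding t_def BS_a_int_pow
    by (simp add: BS_def presented_group_mult presented_group_inv_generator word_power_def)
  then have "BS_a m n [^]\<^bsub>BS m n\<^esub> n \<otimes>\<^bsub>BS m n\<^esub> t =
     t \<otimes>\<^bsub>BS m n\<^esub> (BS_a m n [^]\<^bsub>BS m n\<^esub> m \<otimes>\<^bsub>BS m n\<^esub> inv\<^bsub>BS m n\<^esub> t) \<otimes>\<^bsub>BS m n\<^esub> t" by simp
  also have "\<dots> = t \<otimes>\<^bsub>BS m n\<^esub> BS_a m n [^]\<^bsub>BS m n\<^esub> m"
    using t BS_a_closed[of m n] by (simp add: m_assoc)
  finally show ?thesis .
qed

text \<open>
  The generator \<open>a\<close> commutes with its own powers, and the defining relation says that \<open>t\<close> conjugates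
  \<open>a [^] m\<close> to \<open>a [^] n\<close>, where both exponents are non-zero.
\<close>
lemma BS_commensurates_a:
  assumes mn: "m \<noteq> 0" "n \<noteq> 0" and g: "g \<in> carrier (BS m n)"
  obtains k l :: int where "k \<noteq> 0"
    "BS_a m n [^]\<^bsub>BS m n\<^esub> k \<otimes>\<^bsub>BS m n\<^esub> g = g \<otimes>\<^bsub>BS m n\<^esub> BS_a m n [^]\<^bsub>BS m n\<^esub> l"
proof -
  interpret group "BS m n" by (rule group_BS)
  let ?K = "{g \<in> carrier (BS m n). \<exists>(k::int) (l::int). k \<noteq> 0 \<and> l \<noteq> 0 \<and>
    BS_a m n [^]\<^bsub>BS m n\<^esub> k \<otimes>\<^bsub>BS m n\<^esub> g = g \<otimes>\<^bsub>BS m n\<^esub> BS_a m n [^]\<^bsub>BS m n\<^esub> l}"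
  have K: "subgroup ?K (BS m n)"
    by (rule subgroup_commensurator_cyclic[OF BS_a_closed])
  have "word_class (BS_relations m n) [(x, True)] \<in> ?K" for x
  proof (cases x)
    case Gen_a
    then have x: "word_class (BS_relations m n) [(x, True)] = BS_a m n"
      by (simp add: BS_a_def word_power_def)
    have "\<exists>(k::int) (l::int). k \<noteq> 0 \<and> l \<noteq> 0 \<and> BS_a m n [^]\<^bsub>BS m n\<^esub> k \<otimes>\<^bsub>BS m n\<^esub> BS_a m n
        = BS_a m n \<otimes>\<^bsub>BS m n\<^esub> BS_a m n [^]\<^bsub>BS m n\<^esub> l"
      by (intro exI[of _ "1::int"] conjI) (simp_all add: BS_a_closed)
    then show ?thesis by (simp add: x BS_a_closed)
  next
    case Gen_t
    then show ?thesis
      using BS_relation[of m n] mn word_class_closed[of "BS_relations m n" "[(Gen_t, True)]"]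
      unfolding BS_def[symmetric] by blast
  qed
  then have "carrier (BS m n) \<subseteq> ?K"
    using carrier_presented_group_subset[of ?K "BS_relations m n"] K unfolding BS_def by blast
  then show thesis using g that by blast
qed

lemma BS_perm_eq_coset_action:
  "BS_perm m n = coset_action (BS m n) (generate (BS m n) {BS_a m n})"
  by (simp add: fun_eq_iff BS_perm_def coset_action_def BS_cosets_def)

theorem mainTheorem4:
  fixes m n :: int
  assumes "m \<noteq> 0" and "n \<noteq> 0" and "\<bar>m\<bar> \<noteq> \<bar>n\<bar>"
  shows "kernel (BS m n) (BijGroup (BS_cosets m n)) (BS_perm m n) = {\<one>\<^bsub>BS m n\<^esub>} \<and>
    topological_group (BS_closure m n) (BS_closure_topology m n) \<and>
    totally_disconnected_space (BS_closure_topology m n) \<and>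
    locally_compact_space (BS_closure_topology m n) \<and>
    Hausdorff_space (BS_closure_topology m n) \<and>
    BS_perm m n \<in> mon (BS m n) (BS_closure m n) \<and>
    subgroup (BS_perm m n ` carrier (BS m n)) (BS_closure m n) \<and>
    BS_closure_topology m n closure_of (BS_perm m n ` carrier (BS m n)) =
      topspace (BS_closure_topology m n)"
proof -
  let ?G = "BS m n" and ?a = "BS_a m n" and ?S = "BS_cosets m n" and ?\<pi> = "BS_perm m n"
  let ?H = "generate ?G {?a}" and ?B = "BijGroup ?S" and ?T = "sym_topology ?S"
  let ?\<Gamma> = "?\<pi> ` carrier ?G"
  let ?C = "?T closure_of ?\<Gamma>"
  interpret group ?G by (rule group_BS)
  interpret B: group ?B by (rule group_BijGroup)
  have H: "subgroup ?H ?G" using BS_a_closed by (simp add: generate_is_subgroup)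
  have hom: "?\<pi> \<in> hom ?G ?B"
    unfolding BS_perm_eq_coset_action BS_cosets_def by (rule coset_action_hom[OF H])
  interpret \<pi>: group_hom ?G ?B ?\<pi>
    using hom by unfold_locales
  have \<Gamma>: "subgroup ?\<Gamma> ?B" by (rule \<pi>.img_is_subgroup)
  have C: "subgroup ?C ?B"
    by (rule subgroup_closure_of[OF topological_group_sym_topology \<Gamma>])
  have \<Gamma>C: "?\<Gamma> \<subseteq> ?C"
    using subgroup.subset[OF \<Gamma>]
    by (simp add: closure_of_subset topspace_sym_topology carrier_BijGroup)
  have carr: "BS_closure m n = ?B\<lparr>carrier := ?C\<rparr>" by (simp add: BS_closure_def)
  have top: "BS_closure_topology m n = subtopology ?T ?C"
    by (simp add: BS_closure_topology_def carr)

  have t: "word_class (BS_relations m n) [(Gen_t, True)] \<in> carrier ?G"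
    by (simp add: BS_def word_class_closed)
  have ker: "kernel ?G ?B ?\<pi> = {\<one>\<^bsub>?G\<^esub>}"
  proof (rule trivial_normal_subgroup_of_cyclic[OF BS_a_closed t _ BS_relation assms])
    show "i = 0" if "?a [^]\<^bsub>?G\<^esub> i = \<one>\<^bsub>?G\<^esub>" for i :: int
      by (rule BS_a_infinite_order[OF assms(1,2) that])
    show "kernel ?G ?B ?\<pi> \<lhd> ?G"
      unfolding BS_perm_eq_coset_action BS_cosets_def by (rule normal_kernel_coset_action[OF H])
    show "kernel ?G ?B ?\<pi> \<subseteq> ?H"
      unfolding BS_perm_eq_coset_action BS_cosets_def by (rule kernel_coset_action_subset[OF H])
  qed

  have base: "?H \<in> ?S"
    using lcosetsI[OF one_closed, of ?H] subgroup.subset[OF H]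
    by (simp add: BS_cosets_def lcos_mult_one)
  have "locally_compact_space (subtopology ?T ?C)"
  proof (rule locally_compact_space_closure_of_permutations[OF \<Gamma> base])
    fix c assume "c \<in> ?S"
    then obtain g where g: "g \<in> carrier ?G" "c = g <#\<^bsub>?G\<^esub> ?H"
      unfolding BS_cosets_def by (rule lcosetsE)
    obtain k l :: int where kl: "k \<noteq> 0"
      "?a [^]\<^bsub>?G\<^esub> k \<otimes>\<^bsub>?G\<^esub> g = g \<otimes>\<^bsub>?G\<^esub> ?a [^]\<^bsub>?G\<^esub> l"
      by (rule BS_commensurates_a[OF assms(1,2) g(1)])
    have "{x c | x. x \<in> ?\<Gamma> \<and> x ?H = ?H} \<subseteq> {(h \<otimes>\<^bsub>?G\<^esub> g) <#\<^bsub>?G\<^esub> ?H | h. h \<in> ?H}"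
    proof
      fix d assume "d \<in> {x c | x. x \<in> ?\<Gamma> \<and> x ?H = ?H}"
      then obtain h where h: "h \<in> carrier ?G" "?\<pi> h ?H = ?H" "d = ?\<pi> h c" by auto
      then have "h \<in> ?H"
        using coset_action_one_coset[OF H h(1)] lcoset_eq_self_iff[OF H h(1)]
        by (simp add: BS_perm_eq_coset_action)
      moreover have "d = (h \<otimes>\<^bsub>?G\<^esub> g) <#\<^bsub>?G\<^esub> ?H"
        using coset_action_apply[OF H h(1) g(1)] h(3) g(2) by (simp add: BS_perm_eq_coset_action)
      ultimately show "d \<in> {(h \<otimes>\<^bsub>?G\<^esub> g) <#\<^bsub>?G\<^esub> ?H | h. h \<in> ?H}" by blast
    qed
    then show "finite {x c | x. x \<in> ?\<Gamma> \<and> x ?H = ?H}"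
      by (rule finite_subset) (rule finite_cyclic_orbit_on_cosets[OF BS_a_closed g(1) kl])
  qed
  moreover have "?\<pi> \<in> mon ?G (?B\<lparr>carrier := ?C\<rparr>)"
    using hom \<Gamma>C \<pi>.inj_iff_trivial_ker ker by (auto simp: mon_def hom_def)
  moreover have "subgroup ?\<Gamma> (?B\<lparr>carrier := ?C\<rparr>)"
    by (rule B.subgroup_incl[OF \<Gamma> C \<Gamma>C])
  moreover have "subtopology ?T ?C closure_of ?\<Gamma> = topspace (subtopology ?T ?C)"
    using \<Gamma>C closure_of_subset_topspace[of ?T ?\<Gamma>] by (auto simp: closure_of_subtopology inf_absorb2)
  ultimately show ?thesis
    unfolding carr top
    using ker topological_group_subtopology[OF topological_group_sym_topology C]
      totally_disconnected_space_subtopology[OF totally_disconnected_space_sym_topology]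
      Hausdorff_space_subtopology[OF Hausdorff_space_sym_topology]
    by blast
qed

end
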